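(* Let $\Omega\subset\mathbb{R}^n$ be a domain with the following property: for any $x_0\in\partial\Omega$ and any $s>0$ small, there exist $\nu\in C(\overline{\Omega}\cap B_s(x_0);\mathbb{R}^n)$ and $c>0$ small such that $B_{c\tau}(y+\tau\nu(y))\subset\Omega$ for all $y\in\overline{\Omega}\cap B_s(x_0)$ and $0<\tau\le c$. Let $F:\Omega\times\mathbb{R}^n\times\mathbb{S}^n\to\mathbb{R}$ satisfy: (i) $F\in C(\Omega\times\mathbb{R}^n\times\mathbb{S}^n)$; (ii) $F(x,p,X)\le F(x,p,Y)$ for all $x\in\Omega$, $p\in\mathbb{R}^n$ and $X,Y\in\mathbb{S}^n$ with $X\ge Y$; (iii) for any modulus of continuity $\omega$, $$\sup\{|F(x,p,X)|:\ x\in\Omega,\ d(x)\le\delta,\ |p|\le\omega(\delta)/\delta,\ |X|\le\omega(\delta)/\delta^2\}\to0\quad\text{as }\delta\to0.$$ Let $u\in C(\Omega)$ be a bounded viscosity solution of $u+F(x,\nabla u,\nabla^2u)=0$ in $\Omega$ that can be extended to $u\in C(\overline{\Omega})$. Then $u=0$ on $\partial\Omega$.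
   Context: $\mathbb{S}^n$ is the set of all real symmetric $n\times n$ matrices with the usual partial order; $B_r(x)$ is the open ball centered at $x$ with radius $r$; $d(x)$ denotes the distance from $x\in\overline{\Omega}$ to $\partial\Omega$. A modulus of continuity is a nonnegative increasing function $\omega\in C([0,\infty))$ with $\omega(0)=0$. Viscosity solutions. A locally bounded upper (resp. lower) semicontinuous function $u$ in $\Omega$ is a viscosity subsolution (resp. supersolution) of $u+F(x,\nabla u,\nabla^2u)=0$ in $\Omega$ if whenever $x_0\in\Omega$ and $\varphi\in C^2(\Omega)$ are such that $u-\varphi$ attains a local maximum (resp. minimum) at $x_0$, one has $u(x_0)+F(x_0,\nabla\varphi(x_0),\nabla^2\varphi(x_0))\le0$ (resp. $\ge0$). A function $u\in C(\Omega)$ is a viscosity solution if it is both a viscosity subsolution and a viscosity supersolution. *)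

theory Defs
  imports "HOL-Analysis.Analysis"
begin

definition sym_mats :: "(real^'n^'n) set" where
  "sym_mats = {X. transpose X = X}"

(* The partial order on symmetric matrices; the order that the library puts on
   real^'n^'n is componentwise and is not the one meant here. *)
definition loewner_le :: "real^'n^'n \<Rightarrow> real^'n^'n \<Rightarrow> bool" where
  "loewner_le X Y \<longleftrightarrow> (\<forall>\<xi>. \<xi> \<bullet> (X *v \<xi>) \<le> \<xi> \<bullet> (Y *v \<xi>))"

definition grad :: "(real^'n \<Rightarrow> real) \<Rightarrow> real^'n \<Rightarrow> real^'n" where
  "grad \<phi> x = (\<chi> i. frechet_derivative \<phi> (at x) (axis i 1))"

definition hess :: "(real^'n \<Rightarrow> real) \<Rightarrow> real^'n \<Rightarrow> real^'n^'n" where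
  "hess \<phi> x = jacobian (grad \<phi>) (at x)"

(* Meant for open \<Omega>. The differentiability conditions are needed because
   grad and hess are unspecified where the derivatives do not exist. *)
definition C2_on :: "(real^'n) set \<Rightarrow> (real^'n \<Rightarrow> real) \<Rightarrow> bool" where
  "C2_on \<Omega> \<phi> \<longleftrightarrow>
     (\<forall>x\<in>\<Omega>. \<phi> differentiable (at x)) \<and>
     (\<forall>x\<in>\<Omega>. grad \<phi> differentiable (at x)) \<and>
     continuous_on \<Omega> (hess \<phi>)"

definition usc_on :: "'a::topological_space set \<Rightarrow> ('a \<Rightarrow> real) \<Rightarrow> bool" where
  "usc_on S u \<longleftrightarrow> (\<forall>x\<in>S. \<forall>a. u x < a \<longrightarrow> (\<forall>\<^sub>F y in at x within S. u y < a))"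

definition lsc_on :: "'a::topological_space set \<Rightarrow> ('a \<Rightarrow> real) \<Rightarrow> bool" where
  "lsc_on S u \<longleftrightarrow> (\<forall>x\<in>S. \<forall>a. a < u x \<longrightarrow> (\<forall>\<^sub>F y in at x within S. a < u y))"

definition locally_bounded_on :: "'a::metric_space set \<Rightarrow> ('a \<Rightarrow> real) \<Rightarrow> bool" where
  "locally_bounded_on S u \<longleftrightarrow> (\<forall>x\<in>S. \<exists>e>0. bounded (u ` (S \<inter> ball x e)))"

definition local_max_on :: "'a::metric_space set \<Rightarrow> ('a \<Rightarrow> real) \<Rightarrow> 'a \<Rightarrow> bool" where
  "local_max_on S f x \<longleftrightarrow> x \<in> S \<and> (\<exists>e>0. \<forall>y\<in>S \<inter> ball x e. f y \<le> f x)"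

definition local_min_on :: "'a::metric_space set \<Rightarrow> ('a \<Rightarrow> real) \<Rightarrow> 'a \<Rightarrow> bool" where
  "local_min_on S f x \<longleftrightarrow> x \<in> S \<and> (\<exists>e>0. \<forall>y\<in>S \<inter> ball x e. f x \<le> f y)"

(* The three notions below refer to the equation u + F(x, grad u, hess u) = 0:
   F is the part of the equation without the zeroth-order term u. *)
definition viscosity_subsolution ::
  "(real^'n) set \<Rightarrow> (real^'n \<Rightarrow> real^'n \<Rightarrow> real^'n^'n \<Rightarrow> real) \<Rightarrow> (real^'n \<Rightarrow> real) \<Rightarrow> bool" where
  "viscosity_subsolution \<Omega> F u \<longleftrightarrow>
     locally_bounded_on \<Omega> u \<and> usc_on \<Omega> u \<and>
     (\<forall>x\<^sub>0\<in>\<Omega>. \<forall>\<phi>. C2_on \<Omega> \<phi> \<longrightarrow> local_max_on \<Omega> (\<lambda>x. u x - \<phi> x) x\<^sub>0 \<longrightarrow>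
        u x\<^sub>0 + F x\<^sub>0 (grad \<phi> x\<^sub>0) (hess \<phi> x\<^sub>0) \<le> 0)"

definition viscosity_supersolution ::
  "(real^'n) set \<Rightarrow> (real^'n \<Rightarrow> real^'n \<Rightarrow> real^'n^'n \<Rightarrow> real) \<Rightarrow> (real^'n \<Rightarrow> real) \<Rightarrow> bool" where
  "viscosity_supersolution \<Omega> F u \<longleftrightarrow>
     locally_bounded_on \<Omega> u \<and> lsc_on \<Omega> u \<and>
     (\<forall>x\<^sub>0\<in>\<Omega>. \<forall>\<phi>. C2_on \<Omega> \<phi> \<longrightarrow> local_min_on \<Omega> (\<lambda>x. u x - \<phi> x) x\<^sub>0 \<longrightarrow>
        u x\<^sub>0 + F x\<^sub>0 (grad \<phi> x\<^sub>0) (hess \<phi> x\<^sub>0) \<ge> 0)"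

definition viscosity_solution ::
  "(real^'n) set \<Rightarrow> (real^'n \<Rightarrow> real^'n \<Rightarrow> real^'n^'n \<Rightarrow> real) \<Rightarrow> (real^'n \<Rightarrow> real) \<Rightarrow> bool" where
  "viscosity_solution \<Omega> F u \<longleftrightarrow>
     continuous_on \<Omega> u \<and> viscosity_subsolution \<Omega> F u \<and> viscosity_supersolution \<Omega> F u"

definition modulus_of_continuity :: "(real \<Rightarrow> real) \<Rightarrow> bool" where
  "modulus_of_continuity \<omega> \<longleftrightarrow>
     continuous_on {0..} \<omega> \<and> mono_on {0..} \<omega> \<and> (\<forall>t\<ge>0. 0 \<le> \<omega> t) \<and> \<omega> 0 = 0"

(* The supremum in the growth condition near the boundary. It may be infinite,
   hence ennreal. The norm on matrices is the library's, i.e. the Frobenius norm. *)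
definition boundary_sup ::
  "(real^'n) set \<Rightarrow> (real^'n \<Rightarrow> real^'n \<Rightarrow> real^'n^'n \<Rightarrow> real) \<Rightarrow> (real \<Rightarrow> real) \<Rightarrow> real \<Rightarrow> ennreal" where
  "boundary_sup \<Omega> F \<omega> \<delta> =
     Sup {ennreal \<bar>F x p X\<bar> | x p X. x \<in> \<Omega> \<and> infdist x (frontier \<Omega>) \<le> \<delta> \<and>
            norm p \<le> \<omega> \<delta> / \<delta> \<and> X \<in> sym_mats \<and> norm X \<le> \<omega> \<delta> / \<delta>\<^sup>2}"

definition interior_ball_property :: "(real^'n) set \<Rightarrow> bool" where
  "interior_ball_property \<Omega> \<longleftrightarrow>
     (\<forall>x\<^sub>0\<in>frontier \<Omega>. \<forall>\<^sub>F s in at_right 0.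
        \<exists>\<nu> :: real^'n \<Rightarrow> real^'n. \<exists>c>0.
          continuous_on (closure \<Omega> \<inter> ball x\<^sub>0 s) \<nu> \<and>
          (\<forall>y\<in>closure \<Omega> \<inter> ball x\<^sub>0 s. \<forall>\<tau>. 0 < \<tau> \<and> \<tau> \<le> c \<longrightarrow>
             ball (y + \<tau> *\<^sub>R \<nu> y) (c * \<tau>) \<subseteq> \<Omega>))"

end

theory Submission
  imports Defs
begin

text \<open>
  Near a boundary point \<open>x\<^sub>0\<close> the domain contains balls of radius \<open>r\<close> comparable to their
  distance \<open>\<delta>\<close> from \<open>x\<^sub>0\<close>.  On such a ball \<open>u\<close> varies by at most \<open>2 \<omega>(\<delta>)\<close> for a modulus
  \<open>\<omega>\<close>, so a paraboloid of opening \<open>\<plusminus> 3 \<omega>(\<delta>) / r\<^sup>2\<close> about its centre touches \<open>u\<close> from above (below)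
  at an interior point \<open>x\<^sub>1\<close>.  Its gradient and Hessian there are of order \<open>\<omega>(\<delta>) / \<delta>\<close> and
  \<open>\<omega>(\<delta>) / \<delta>\<^sup>2\<close>, so the equation forces \<open>\<plusminus> u(x\<^sub>1) \<le> o(1)\<close>, and \<open>u(x\<^sub>1)\<close> tends to the value at \<open>x\<^sub>0\<close>.
\<close>

section \<open>Continuous moduli of continuity at a point\<close>

text \<open>The supremum of |f x - f x0| over dist x x0 \<le> t is increasing but may jump in t. The
  factor \<open>min 1 (t / dist x x0)\<close> replaces this sharp cut-off: it is increasing and
  subadditive in t \<ge> 0, both properties pass to the supremum, and a subadditive modulus is
  continuous as soon as it is continuous at 0. Boundedness of f keeps the supremum finite and
  controls the points far from x0.\<close>

lemma modulus_of_continuity_at_point: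
  fixes f :: "'a::metric_space \<Rightarrow> real"
  assumes cont: "continuous_on S f" and x0: "x0 \<in> S" and bdd: "bounded (f ` S)"
  obtains \<omega> where "modulus_of_continuity \<omega>"
    and "\<And>x. x \<in> S \<Longrightarrow> \<bar>f x - f x0\<bar> \<le> \<omega> (dist x x0)"
proof -
  define g where "g t x = \<bar>f x - f x0\<bar> * min 1 (t / dist x x0)" for t x
  define \<omega> where "\<omega> t = (SUP x\<in>S. g t x)" for t
  obtain B where B: "\<And>x. x \<in> S \<Longrightarrow> \<bar>f x\<bar> \<le> B"
    using bdd unfolding bounded_iff by auto
  have B2: "\<bar>f x - f x0\<bar> \<le> 2 * B" if "x \<in> S" for x
    using B[OF that] B[OF x0] by linarith
  have B0: "0 \<le> B" using B[OF x0] by linarith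
  have g_le: "g t x \<le> \<bar>f x - f x0\<bar>" for t x
    unfolding g_def by (simp add: mult_left_le)
  have g_le2: "g t x \<le> 2 * B" if "x \<in> S" for t x
    using g_le[of t x] B2[OF that] by linarith
  have bdd_g: "bdd_above (g t ` S)" for t
    using g_le2 by (auto intro!: bdd_aboveI2)
  have up: "g t x \<le> \<omega> t" if "x \<in> S" for t x
    unfolding \<omega>_def by (rule cSUP_upper[OF that bdd_g])
  have least: "\<omega> t \<le> b" if "\<And>x. x \<in> S \<Longrightarrow> g t x \<le> b" for t b
    unfolding \<omega>_def using x0 that by (intro cSUP_least) auto
  have g0: "0 \<le> g t x" if "0 \<le> t" for t x
    unfolding g_def using that by simp
  have nonneg: "0 \<le> \<omega> t" if "0 \<le> t" for t
    using up[OF x0, of t] g0[OF that, of x0] by linarith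
  have g_mono: "g s x \<le> g t x" if "s \<le> t" for s t x
    unfolding g_def using that
    by (intro mult_left_mono min.mono divide_right_mono) auto
  have mono: "\<omega> s \<le> \<omega> t" if "s \<le> t" for s t
    using up g_mono[OF that] by (intro least) (meson order_trans)
  have min_subadd: "min 1 (a + b) \<le> min 1 a + min 1 b" if "0 \<le> a" "0 \<le> b" for a b :: real
    using that by (auto simp: min_def)
  have g_subadd: "g (s + t) x \<le> g s x + g t x" if "0 \<le> s" "0 \<le> t" for s t x
    unfolding g_def distrib_left[symmetric] add_divide_distrib using that
    by (intro mult_left_mono min_subadd) auto
  have subadd: "\<omega> (s + t) \<le> \<omega> s + \<omega> t" if "0 \<le> s" "0 \<le> t" for s t
    using up g_subadd[OF that] by (intro least) (meson add_mono order_trans)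
  have zero: "\<omega> 0 = 0"
    using least[of 0 0] nonneg[of 0] by (simp add: g_def)
  have small: "\<exists>d>0. \<forall>t. 0 \<le> t \<and> t < d \<longrightarrow> \<omega> t < e" if "0 < e" for e
  proof -
    obtain \<rho> where \<rho>: "0 < \<rho>" "\<And>x. x \<in> S \<Longrightarrow> dist x x0 < \<rho> \<Longrightarrow> \<bar>f x - f x0\<bar> < e / 2"
      using cont[unfolded continuous_on_iff dist_real_def, rule_format, OF x0, of "e / 2"] \<open>0 < e\<close>
      by auto
    \<comment> \<open>At distance at least \<rho> from x0, \<open>g t x\<close> is at most 2 B t /
      \<rho>, so t < d brings it below e / 2. The summand 1 keeps the denominator positive when B =
      0.\<close>
    define d where "d = \<rho> * (e / 2) / (2 * B + 1)"
    have "\<omega> t < e" if t: "0 \<le> t" "t < d" for t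
    proof -
      have "g t x \<le> e / 2" if x: "x \<in> S" for x
      proof (cases "dist x x0 < \<rho>")
        case True
        then show ?thesis using \<rho>(2)[OF x] g_le[of t x] by linarith
      next
        case False
        have "g t x \<le> (2 * B) * (t / \<rho>)"
          unfolding g_def
        proof (rule mult_mono)
          show "min 1 (t / dist x x0) \<le> t / \<rho>"
            using False \<rho>(1) t(1)
            by (intro min.coboundedI2 divide_left_mono mult_pos_pos) linarith+
        qed (use B2[OF x] B0 t(1) in auto)
        also have "\<dots> \<le> (2 * B) * (d / \<rho>)"
          using t B0 \<rho>(1) by (intro mult_left_mono divide_right_mono) auto
        also have "\<dots> = (2 * B) / (2 * B + 1) * (e / 2)"
          using \<rho>(1) by (simp add: d_def)
        also have "\<dots> \<le> e / 2"
          using B0 \<open>0 < e\<close> by (intro mult_left_le_one_le) auto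
        finally show ?thesis .
      qed
      then have "\<omega> t \<le> e / 2" by (rule least)
      then show ?thesis using \<open>0 < e\<close> by linarith
    qed
    moreover have "0 < d" using \<rho>(1) \<open>0 < e\<close> B0 by (simp add: d_def)
    ultimately show ?thesis by blast
  qed
  \<comment> \<open>By monotonicity and subadditivity, continuity at 0 implies continuity everywhere.\<close>
  have diff: "\<bar>\<omega> t - \<omega> s\<bar> \<le> \<omega> \<bar>t - s\<bar>" if "0 \<le> s" "0 \<le> t" for s t
  proof (cases "s \<le> t")
    case True
    then show ?thesis using subadd[of s "t - s"] mono[of s t] that by auto
  next
    case False
    then show ?thesis using subadd[of t "s - t"] mono[of t s] that by auto
  qed
  have "continuous_on {0..} \<omega>"
    unfolding continuous_on_iff dist_real_def
  proof (intro ballI allI impI)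
    fix s e :: real assume s: "s \<in> {0..}" and e: "0 < e"
    obtain d where d: "0 < d" "\<And>t. 0 \<le> t \<Longrightarrow> t < d \<Longrightarrow> \<omega> t < e"
      using small[OF e] by blast
    have "\<bar>\<omega> t - \<omega> s\<bar> < e" if "t \<in> {0..}" "\<bar>t - s\<bar> < d" for t
      using diff[of s t] d(2)[of "\<bar>t - s\<bar>"] s that by force
    then show "\<exists>d>0. \<forall>t\<in>{0..}. \<bar>t - s\<bar> < d \<longrightarrow> \<bar>\<omega> t - \<omega> s\<bar> < e"
      using d(1) by blast
  qed
  then have "modulus_of_continuity \<omega>"
    unfolding modulus_of_continuity_def using zero nonneg mono by (auto intro!: mono_onI)
  \<comment> \<open>For t = dist x x0 the cut-off factor is 1, except at x = x0, where division by
    zero makes it 0 but the left side vanishes.\<close>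
  moreover have "\<bar>f x - f x0\<bar> \<le> \<omega> (dist x x0)" if "x \<in> S" for x
    using up[OF that, of "dist x x0"] by (cases "x = x0") (auto simp: g_def nonneg)
  ultimately show ?thesis by (rule that)
qed

section \<open>Paraboloids as test functions\<close>

lemma grad_paraboloid:
  fixes y :: "real^'n"
  shows "grad (\<lambda>x. k * (norm (x - y))\<^sup>2) x = (2 * k) *\<^sub>R (x - y)"
    and "(\<lambda>x. k * (norm (x - y))\<^sup>2) differentiable (at x)"
proof -
  have D: "((\<lambda>x. k * (norm (x - y))\<^sup>2) has_derivative (\<lambda>h. 2 * k * ((x - y) \<bullet> h))) (at x)"
    unfolding power2_norm_eq_inner
    by (auto intro!: derivative_eq_intros simp: inner_commute algebra_simps)
  then show "(\<lambda>x. k * (norm (x - y))\<^sup>2) differentiable (at x)"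
    by (rule differentiableI)
  show "grad (\<lambda>x. k * (norm (x - y))\<^sup>2) x = (2 * k) *\<^sub>R (x - y)"
    unfolding grad_def frechet_derivative_at[OF D, symmetric]
    by (simp add: vec_eq_iff inner_axis)
qed

lemma hess_paraboloid:
  fixes y :: "real^'n"
  shows "hess (\<lambda>x. k * (norm (x - y))\<^sup>2) x = (2 * k) *\<^sub>R mat 1"
    and "grad (\<lambda>x. k * (norm (x - y))\<^sup>2) differentiable (at x)"
proof -
  have eq: "grad (\<lambda>x. k * (norm (x - y))\<^sup>2) = (\<lambda>x. (2 * k) *\<^sub>R (x - y))"
    using grad_paraboloid(1) by blast
  have D: "((\<lambda>x. (2 * k) *\<^sub>R (x - y)) has_derivative (\<lambda>h. (2 * k) *\<^sub>R h)) (at x)"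
    by (auto intro!: derivative_eq_intros)
  then show "grad (\<lambda>x. k * (norm (x - y))\<^sup>2) differentiable (at x)"
    unfolding eq by (rule differentiableI)
  show "hess (\<lambda>x. k * (norm (x - y))\<^sup>2) x = (2 * k) *\<^sub>R mat 1"
    unfolding hess_def eq jacobian_def frechet_derivative_at[OF D, symmetric]
    by (simp add: vec_eq_iff matrix_def mat_def axis_def)
qed

lemma C2_on_paraboloid:
  fixes y :: "real^'n"
  shows "C2_on S (\<lambda>x. k * (norm (x - y))\<^sup>2)"
  unfolding C2_on_def hess_paraboloid(1) using grad_paraboloid(2) hess_paraboloid(2) by auto

text \<open>On the bounding sphere the paraboloid equals 3 m, while f varies by at most 2 m over the
  ball. Hence the centre, where the paraboloid vanishes, beats every point of the sphere, and a
  maximiser over the compact ball is interior.\<close>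

lemma paraboloid_touches:
  fixes f :: "'a::{real_normed_vector, heine_borel} \<Rightarrow> real"
  assumes cont: "continuous_on (cball y r) f" and r: "0 < r" and m: "0 < m"
    and near: "\<And>x. x \<in> cball y r \<Longrightarrow> \<bar>f x - a\<bar> \<le> m"
  obtains x1 where "x1 \<in> ball y r"
    and "\<And>x. x \<in> cball y r \<Longrightarrow>
      f x - 3 * m / r\<^sup>2 * (norm (x - y))\<^sup>2 \<le> f x1 - 3 * m / r\<^sup>2 * (norm (x1 - y))\<^sup>2"
proof -
  let ?h = "\<lambda>x. f x - 3 * m / r\<^sup>2 * (norm (x - y))\<^sup>2"
  have "continuous_on (cball y r) ?h"
    using cont by (intro continuous_intros) auto
  then obtain x1 where x1: "x1 \<in> cball y r" "\<And>x. x \<in> cball y r \<Longrightarrow> ?h x \<le> ?h x1"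
    using continuous_attains_sup[of "cball y r" ?h] r by auto
  have "norm (x1 - y) \<noteq> r"
  proof
    assume "norm (x1 - y) = r"
    then have "f y \<le> f x1 - 3 * m"
      using x1(2)[of y] r by simp
    then show False
      using near[OF x1(1)] near[of y] r m by auto
  qed
  then have "x1 \<in> ball y r"
    using x1(1) by (simp add: dist_norm norm_minus_commute)
  then show ?thesis using x1(2) by (rule that)
qed

section \<open>The growth condition near the boundary\<close>

lemma scaleR_mat_1_in_sym_mats: "k *\<^sub>R mat 1 \<in> sym_mats"
  by (simp add: sym_mats_def transpose_def mat_def vec_eq_iff)

lemma boundary_sup_lessD:
  assumes less: "boundary_sup \<Omega> F \<omega> \<delta> < ennreal e" and "x \<in> \<Omega>"
    and "infdist x (frontier \<Omega>) \<le> \<delta>" and "norm p \<le> \<omega> \<delta> / \<delta>"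
    and "X \<in> sym_mats" and "norm X \<le> \<omega> \<delta> / \<delta>\<^sup>2"
  shows "\<bar>F x p X\<bar> < e"
proof -
  have "ennreal \<bar>F x p X\<bar> \<le> boundary_sup \<Omega> F \<omega> \<delta>"
    unfolding boundary_sup_def using assms(2-) by (intro Sup_upper) blast
  then have "ennreal \<bar>F x p X\<bar> < ennreal e" using less by (rule le_less_trans)
  then show ?thesis by (simp add: ennreal_less_iff)
qed

text \<open>Provides the modulus to which the growth condition is applied. The summand t makes it
  positive for t > 0 even where \<omega> vanishes, as the strict bound in
  \<open>paraboloid_touches\<close> demands; C absorbs the geometric constants.\<close>

lemma modulus_of_continuity_add_id_scaled:
  assumes "modulus_of_continuity \<omega>" and "0 \<le> C"
  shows "modulus_of_continuity (\<lambda>t. C * (\<omega> t + t))"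
  using assms unfolding modulus_of_continuity_def
  by (auto intro!: continuous_intros mono_onI mult_left_mono add_mono dest: mono_onD)

section \<open>Vanishing of the boundary values\<close>

theorem proposition3p1:
  fixes \<Omega> :: "(real^'n) set"
    and F :: "real^'n \<Rightarrow> real^'n \<Rightarrow> real^'n^'n \<Rightarrow> real"
    and u ubar :: "real^'n \<Rightarrow> real"
  assumes domain: "open \<Omega>" "connected \<Omega>" "\<Omega> \<noteq> {}"
    and interior_ball: "interior_ball_property \<Omega>"
    and F_cont: "continuous_on (\<Omega> \<times> UNIV \<times> sym_mats) (\<lambda>(x, p, X). F x p X)"
    and F_elliptic: "\<And>x p X Y. x \<in> \<Omega> \<Longrightarrow> X \<in> sym_mats \<Longrightarrow> Y \<in> sym_mats \<Longrightarrow>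
          loewner_le Y X \<Longrightarrow> F x p X \<le> F x p Y"
    and F_boundary: "\<And>\<omega>. modulus_of_continuity \<omega> \<Longrightarrow>
          (boundary_sup \<Omega> F \<omega> \<longlongrightarrow> 0) (at_right 0)"
    and u_sol: "viscosity_solution \<Omega> F u"
    and u_bounded: "bounded (u ` \<Omega>)"
    and u_extension: "continuous_on (closure \<Omega>) ubar" "\<And>x. x \<in> \<Omega> \<Longrightarrow> ubar x = u x"
  shows "\<forall>x\<in>frontier \<Omega>. ubar x = 0"
proof
  fix x0 assume fr: "x0 \<in> frontier \<Omega>"
  have x0: "x0 \<in> closure \<Omega>" using fr by (simp add: frontier_def)
  have "bounded (closure (u ` \<Omega>))" using u_bounded by (rule bounded_closure)
  moreover have "ubar ` closure \<Omega> \<subseteq> closure (u ` \<Omega>)"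
    using u_extension(2) closure_subset[of "u ` \<Omega>"]
    by (intro image_closure_subset[OF u_extension(1)]) auto
  ultimately have "bounded (ubar ` closure \<Omega>)" by (rule bounded_subset)
  then obtain \<omega> where \<omega>: "modulus_of_continuity \<omega>"
    and osc: "\<And>x. x \<in> closure \<Omega> \<Longrightarrow> \<bar>ubar x - ubar x0\<bar> \<le> \<omega> (dist x x0)"
    using modulus_of_continuity_at_point[OF u_extension(1) x0] by blast
  have "\<forall>\<^sub>F s in at_right 0. 0 < s \<and> (\<exists>\<nu> c. 0 < c \<and>
      (\<forall>y\<in>closure \<Omega> \<inter> ball x0 s. \<forall>\<tau>. 0 < \<tau> \<and> \<tau> \<le> c \<longrightarrow>
         ball (y + \<tau> *\<^sub>R \<nu> y) (c * \<tau>) \<subseteq> \<Omega>))"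
    using interior_ball[unfolded interior_ball_property_def, rule_format, OF fr]
      eventually_at_right_less[of 0]
    by eventually_elim blast
  from eventually_happens'[OF trivial_limit_at_right_real this]
  obtain s \<nu> c where s: "0 < s" and c: "0 < c"
    and balls: "\<And>y \<tau>. y \<in> closure \<Omega> \<inter> ball x0 s \<Longrightarrow> 0 < \<tau> \<Longrightarrow> \<tau> \<le> c \<Longrightarrow>
       ball (y + \<tau> *\<^sub>R \<nu> y) (c * \<tau>) \<subseteq> \<Omega>"
    by blast
  \<comment> \<open>The ball of radius c \<tau> about x0 + \<tau> \<nu>(x0) lies within \<tau> L of
    x0, which suggests \<tau> = \<delta> / L. Then r = \<kappa> \<delta> is half of c \<tau>, so
    that the closed ball of radius r fits into the open one. The two summands of C come from the
    gradient bound 6 \<omega>1(\<delta>) / r and from the Hessian norm, 6 \<omega>1(\<delta>) / r^2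
    times the norm of the identity.\<close>
  define L where "L = norm (\<nu> x0) + c"
  define \<kappa> where "\<kappa> = c / (2 * L)"
  define C where "C = 6 / \<kappa> + 6 * norm (mat 1 :: real^'n^'n) / \<kappa>\<^sup>2"
  define \<omega>1 where "\<omega>1 t = \<omega> t + t" for t
  have L: "0 < L" using c by (simp add: L_def add_nonneg_pos)
  have \<kappa>: "0 < \<kappa>" using c L by (simp add: \<kappa>_def)
  have C: "0 \<le> C" using \<kappa> by (simp add: C_def)
  have \<omega>_mono: "\<omega> s \<le> \<omega> t" if "0 \<le> s" "s \<le> t" for s t
    using \<omega> that mono_onD[of "{0..}" \<omega> s t] unfolding modulus_of_continuity_def by simp
  have \<omega>_nonneg: "0 \<le> \<omega> t" if "0 \<le> t" for t
    using \<omega> that unfolding modulus_of_continuity_def by auto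
  have C\<omega>: "modulus_of_continuity (\<lambda>t. C * \<omega>1 t)"
    unfolding \<omega>1_def using \<omega> C by (rule modulus_of_continuity_add_id_scaled)
  have "(\<omega> \<longlongrightarrow> 0) (at 0 within {0..})"
    using \<omega> unfolding modulus_of_continuity_def continuous_on by force
  then have \<omega>_lim: "(\<omega> \<longlongrightarrow> 0) (at_right 0)"
    by (rule tendsto_within_subset) auto
  \<comment> \<open>The sign \<sigma> treats both inequalities at once: \<sigma> = 1 uses the
    subsolution property, \<sigma> = -1 the supersolution property.\<close>
  have sign: "\<sigma> * ubar x0 \<le> 0" if \<sigma>: "\<sigma> = 1 \<or> \<sigma> = -1" for \<sigma> :: real
  proof (rule field_le_epsilon)
    fix e :: real assume e: "0 < e"
    \<comment> \<open>One half of e is reserved for F and the other for the oscillation of u;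
      \<delta> < c L will ensure \<tau> \<le> c.\<close>
    have "\<forall>\<^sub>F \<delta> in at_right 0. boundary_sup \<Omega> F (\<lambda>t. C * \<omega>1 t) \<delta> < ennreal (e / 2)"
      using e by (intro order_tendstoD(2)[OF F_boundary[OF C\<omega>]]) simp
    moreover have "\<forall>\<^sub>F \<delta> in at_right 0. \<omega> \<delta> < e / 2"
      using e by (intro order_tendstoD(2)[OF \<omega>_lim]) simp
    moreover have "\<forall>\<^sub>F \<delta> in at_right 0. \<delta> \<in> {0<..<c * L}"
      using c L by (intro eventually_at_right_real) simp
    ultimately have "\<forall>\<^sub>F \<delta> in at_right 0.
        boundary_sup \<Omega> F (\<lambda>t. C * \<omega>1 t) \<delta> < ennreal (e / 2) \<and> \<omega> \<delta> < e / 2 \<and>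
        0 < \<delta> \<and> \<delta> < c * L"
      by eventually_elim simp
    from eventually_happens'[OF trivial_limit_at_right_real this]
    obtain \<delta> where \<delta>: "boundary_sup \<Omega> F (\<lambda>t. C * \<omega>1 t) \<delta> < ennreal (e / 2)"
      "\<omega> \<delta> < e / 2" "0 < \<delta>" "\<delta> < c * L"
      by blast
    define \<tau> where "\<tau> = \<delta> / L"
    define y where "y = x0 + \<tau> *\<^sub>R \<nu> x0"
    define r where "r = \<kappa> * \<delta>"
    have \<tau>: "0 < \<tau>" "\<tau> \<le> c" using \<delta> L by (auto simp: \<tau>_def field_simps)
    have r: "0 < r" using \<kappa> \<delta> by (simp add: r_def)
    have r2: "r = c * \<tau> / 2" using L by (simp add: r_def \<kappa>_def \<tau>_def)
    have "cball y r \<subseteq> ball y (c * \<tau>)" using r by (auto simp: r2)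
    moreover have "ball y (c * \<tau>) \<subseteq> \<Omega>"
      unfolding y_def using balls[of x0 \<tau>] x0 s \<tau> by simp
    ultimately have sub: "cball y r \<subseteq> \<Omega>" by blast
    have near0: "dist x x0 \<le> \<delta>" if "x \<in> cball y r" for x
    proof -
      have "dist x x0 \<le> r + dist y x0"
        using that dist_triangle[of x x0 y] by (simp add: dist_commute)
      also have "\<dots> \<le> c * \<tau> + \<tau> * norm (\<nu> x0)"
        using c \<tau> by (simp add: r2 y_def dist_norm)
      also have "\<dots> = \<tau> * L" by (simp add: L_def algebra_simps)
      also have "\<dots> = \<delta>" using L by (simp add: \<tau>_def)
      finally show ?thesis .
    qed
    have near: "\<bar>u x - ubar x0\<bar> \<le> \<omega> \<delta>" if "x \<in> cball y r" for x
    proof -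
      have "x \<in> \<Omega>" using sub that by blast
      then have "\<bar>u x - ubar x0\<bar> \<le> \<omega> (dist x x0)"
        using osc[of x] u_extension(2)[of x] closure_subset[of \<Omega>] by auto
      also have "\<dots> \<le> \<omega> \<delta>" using near0[OF that] by (intro \<omega>_mono) auto
      finally show ?thesis .
    qed
    have \<omega>1: "0 < \<omega>1 \<delta>" using \<omega>_nonneg[of \<delta>] \<delta> by (simp add: \<omega>1_def)
    define K where "K = 3 * \<omega>1 \<delta> / r\<^sup>2"
    have cont: "continuous_on (cball y r) (\<lambda>x. \<sigma> * u x)"
      using u_sol sub unfolding viscosity_solution_def
      by (auto intro!: continuous_intros intro: continuous_on_subset)
    have near\<sigma>: "\<bar>\<sigma> * u x - \<sigma> * ubar x0\<bar> \<le> \<omega>1 \<delta>" if "x \<in> cball y r" for x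
      using near[OF that] \<sigma> \<delta>(3) by (auto simp: \<omega>1_def)
    obtain x1 where x1: "x1 \<in> ball y r"
      and touch: "\<And>x. x \<in> cball y r \<Longrightarrow>
        \<sigma> * u x - K * (norm (x - y))\<^sup>2 \<le> \<sigma> * u x1 - K * (norm (x1 - y))\<^sup>2"
      using paraboloid_touches[OF cont r \<omega>1 near\<sigma>] unfolding K_def by blast
    have x1c: "x1 \<in> cball y r" using x1 by auto
    have x1\<Omega>: "x1 \<in> \<Omega>" using sub x1c by blast
    define \<phi> where "\<phi> x = (\<sigma> * K) * (norm (x - y))\<^sup>2" for x
    define p where "p = (2 * (\<sigma> * K)) *\<^sub>R (x1 - y)"
    define X where "X = (2 * (\<sigma> * K)) *\<^sub>R (mat 1 :: real^'n^'n)"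
    have C2: "C2_on \<Omega> \<phi>" and gr: "grad \<phi> x1 = p" and he: "hess \<phi> x1 = X"
      unfolding \<phi>_def p_def X_def
      by (rule C2_on_paraboloid grad_paraboloid hess_paraboloid)+
    obtain \<rho> where \<rho>: "0 < \<rho>" "ball x1 \<rho> \<subseteq> ball y r"
      using x1 openE[OF open_ball] by blast
    \<comment> \<open>Since \<sigma>^2 = 1, multiplying u - \<phi> by \<sigma> gives exactly the
      function maximised in \<open>touch\<close>; thus u - \<phi> has a local maximum or minimum at
      x1 according to \<sigma>.\<close>
    have loc: "\<sigma> * (u x - \<phi> x) \<le> \<sigma> * (u x1 - \<phi> x1)" if "x \<in> ball x1 \<rho>" for x
      using touch[of x] that \<rho>(2) \<sigma> by (auto simp: \<phi>_def)
    have "\<sigma> * (u x1 + F x1 p X) \<le> 0"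
      using \<sigma>
    proof
      assume "\<sigma> = 1"
      then have "local_max_on \<Omega> (\<lambda>x. u x - \<phi> x) x1"
        unfolding local_max_on_def using x1\<Omega> \<rho>(1) loc by auto
      then show ?thesis
        using u_sol C2 x1\<Omega> \<open>\<sigma> = 1\<close> gr he
        unfolding viscosity_solution_def viscosity_subsolution_def by fastforce
    next
      assume "\<sigma> = -1"
      then have "local_min_on \<Omega> (\<lambda>x. u x - \<phi> x) x1"
        unfolding local_min_on_def using x1\<Omega> \<rho>(1) loc
        by (intro conjI exI[of _ \<rho>]) force+
      then show ?thesis
        using u_sol C2 x1\<Omega> \<open>\<sigma> = -1\<close> gr he
        unfolding viscosity_solution_def viscosity_supersolution_def by fastforce
    qed
    moreover have "\<bar>F x1 p X\<bar> < e / 2"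
    proof (rule boundary_sup_lessD[OF \<delta>(1) x1\<Omega>])
      show "infdist x1 (frontier \<Omega>) \<le> \<delta>"
        using infdist_le[OF fr, of x1] near0[OF x1c] by linarith
      have K: "0 \<le> K" using \<omega>1 by (simp add: K_def)
      have abs: "\<bar>2 * (\<sigma> * K)\<bar> = 2 * K" using \<sigma> K by auto
      have "norm p = 2 * K * norm (x1 - y)" by (simp add: p_def abs)
      \<comment> \<open>Here x1 lies within r of the centre, and K r = 3 \<omega>1(\<delta>) / r
        with r = \<kappa> \<delta>.\<close>
      also have "\<dots> \<le> 2 * K * r"
        using K x1 by (intro mult_left_mono) (auto simp: dist_norm norm_minus_commute)
      also have "\<dots> = 6 / \<kappa> * \<omega>1 \<delta> / \<delta>"
        using \<kappa> \<delta>(3) by (simp add: K_def r_def power2_eq_square)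
      also have "\<dots> \<le> C * \<omega>1 \<delta> / \<delta>"
        using \<omega>1 \<delta>(3) \<kappa> by (intro divide_right_mono mult_right_mono) (auto simp: C_def)
      finally show "norm p \<le> C * \<omega>1 \<delta> / \<delta>" .
      show "X \<in> sym_mats" unfolding X_def by (rule scaleR_mat_1_in_sym_mats)
      have "norm X = 2 * K * norm (mat 1 :: real^'n^'n)" by (simp add: X_def abs)
      also have "\<dots> = 6 * norm (mat 1 :: real^'n^'n) / \<kappa>\<^sup>2 * \<omega>1 \<delta> / \<delta>\<^sup>2"
        by (simp add: K_def r_def power_mult_distrib)
      also have "\<dots> \<le> C * \<omega>1 \<delta> / \<delta>\<^sup>2"
        using \<omega>1 \<kappa> by (intro divide_right_mono mult_right_mono) (auto simp: C_def)
      finally show "norm X \<le> C * \<omega>1 \<delta> / \<delta>\<^sup>2" .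
    qed
    moreover have "\<bar>u x1 - ubar x0\<bar> < e / 2" using near[OF x1c] \<delta>(2) by linarith
    \<comment> \<open>The chain is \<sigma> ubar(x0) \<le> \<sigma> u(x1) + e / 2 \<le> -\<sigma>
      F(x1, p, X) + e / 2 \<le> e.\<close>
    ultimately show "\<sigma> * ubar x0 \<le> 0 + e" using \<sigma> by (auto simp: abs_if split: if_splits)
  qed
  from sign[of 1] sign[of "-1"] show "ubar x0 = 0" by simp
qed

end
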